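(* Consider the pulse coupled $3$-oscillator network with coupling strength $\varepsilon\ge0$ and delay $\tau>0$ described in the context. Let $(\boldsymbol\theta,\boldsymbol\sigma)=S(\boldsymbol\sigma)$, $\boldsymbol\sigma\in\Omega_{\varepsilon,\tau}$, and denote by $Y(\boldsymbol\sigma)$ the corresponding periodic orbit, i.e. the one with initial state $S(\boldsymbol\sigma)$. Then for $\Delta\boldsymbol\theta=(\Delta\theta_1,\Delta\theta_2,0)$ and $\Delta\boldsymbol\sigma\in\mathbb R^3$ sufficiently small, the orbit with initial condition $(\boldsymbol\theta+\Delta\boldsymbol\theta,\boldsymbol\sigma+\Delta\boldsymbol\sigma)$ converges in one iteration of the Poincaré map to the periodic orbit $Y(\boldsymbol\sigma+\Delta\boldsymbol\sigma)$.
   Context: Network. There are $N=3$ identical oscillators, coupled all-to-all, with phases $\theta_1,\theta_2,\theta_3\in[0,1]$. Fix $b>0$, $\varepsilon\ge0$, $\tau>0$ and put $\hat\varepsilon=\varepsilon/(N-1)=\varepsilon/2$. For $\delta\ge 0$ let $H(\theta,\delta)=e^{b\delta}\theta+\frac{e^{b\delta}-1}{e^b-1}$ and write $H_m(\theta)=H(\theta,m\hat\varepsilon)$, $H(\theta)=H_1(\theta)$. The dynamics is: $\dot\theta_i=1$ between events; if $\theta_i(t)=1$ then oscillator $i$ fires at time $t$ (sending a pulse to each of the other oscillators, received at time $t+\tau$) and is reset, $\theta_i(t^+)=0$; if $m\ge1$ other oscillators fired at time $t-\tau$ then $\theta_i(t)=\min\{1,H_m(\theta_i(t^-))\}$. States.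 The future dynamics is determined by the phases at $t=0$ and the firing moments in $[-\tau,0]$. A state on the surface of section $\theta_3=0$ written $(\boldsymbol\theta,\boldsymbol\sigma)=(\theta_1,\theta_2,0;\{\sigma_1\},\{\sigma_2\},\{\sigma_3\})$ means: at time $0$ oscillator $3$ has just fired and been reset to phase $0$ (so its pulse will be received by oscillators $1,2$ at time $\tau$), oscillators $1,2$ have phases $\theta_1,\theta_2$, and, apart from the firing of oscillator $3$ at time $0$, the only firing in the last $\tau$ time units of oscillator $i$ was at time $-\sigma_i$, $i=1,2,3$. The Poincaré map sends a state on the section to the state at the next time at which oscillator $3$ fires and is reset to $0$. Converging in one iteration to a periodic orbit means that the image of the initial condition under one iteration of the Poincaré map is a state lying on that orbit. Let $H_*=H_1^{-1}(1)=\frac{e^b-e^{b\hat\varepsilon}}{(e^b-1)e^{b\hat\varepsilon}}$. For $\boldsymbol\sigma=(\sigma_1,\sigma_2,\sigma_3)$ let $F_1=H(\sigma_1)+\tau-\sigma_3$, $F_2=H(\tau-\sigma_3+\sigma_2)+\sigma_3-\sigma_1$, $F_3=H(\tau-\sigma_1)+\sigma_1-\sigma_2$, $F_4=H(\sigma_3-\sigma_2)+\sigma_2$. Let $\Omega_{\varepsilon,\tau}\subset\mathbb R^3$ be the set of $\boldsymbol\sigma$ with $0<\sigma_2<\sigma_1<\sigma_3<\tau$ and $H_*\le F_k\le 1$ for $k=1,2,3,4$. Let $S(\sigma_1,\sigma_2,\sigma_3)=(H(\sigma_1),\sigma_2,0;\{\sigma_1\},\{\sigma_2\},\{\sigma_3\})$.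 For $\boldsymbol\sigma\in\Omega_{\varepsilon,\tau}$ the orbit with initial state $S(\boldsymbol\sigma)$ is periodic (the fourth iterate of the Poincaré map fixes $S(\boldsymbol\sigma)$); these orbits form the isochronous region called IR4.
   Formalization: σ is taken in the interior of Ω rather than in Ω: at boundary points Y(σ+Δσ) is undefined for some arbitrarily small Δσ, and the claim can fail even for Δσ=0 (e.g. ε=0, τ=4/3, Ω={(2/3,1/3,1)}, Δθ₁≠0). *)

theory Defs
  imports "HOL-Analysis.Analysis"
begin

definition pulse :: "real \<Rightarrow> real \<Rightarrow> real \<Rightarrow> real"
  where "pulse b \<theta> \<delta> = exp (b * \<delta>) * \<theta> + (exp (b * \<delta>) - 1) / (exp b - 1)"

definition coupling :: "real \<Rightarrow> real"
  where "coupling \<epsilon> = \<epsilon> / (real CARD(3) - 1)"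

definition Hm :: "real \<Rightarrow> real \<Rightarrow> nat \<Rightarrow> real \<Rightarrow> real"
  where "Hm b \<epsilon> m \<theta> = pulse b \<theta> (real m * coupling \<epsilon>)"

definition Hstar :: "real \<Rightarrow> real \<Rightarrow> real"
  where "Hstar b \<epsilon> =
    (exp b - exp (b * coupling \<epsilon>)) / ((exp b - 1) * exp (b * coupling \<epsilon>))"

lemma Hm_eq_1_iff:
  assumes "b > 0"
  shows "Hm b \<epsilon> 1 \<theta> = 1 \<longleftrightarrow> \<theta> = Hstar b \<epsilon>"
proof -
  have "exp b - 1 > 0" using assms by simp
  moreover have "exp (b * coupling \<epsilon>) > 0" by simp
  ultimately show ?thesis
    unfolding Hm_def pulse_def Hstar_def by (auto simp: field_simps)
qed

text \<open>
  Oscillators are the elements of the three-element type \<open>3\<close>.  A state consists of the phases and,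
  for each oscillator, the set of ages \<open>a\<close> with \<open>0 \<le> a < \<tau>\<close> of its past firings, i.e. the set of
  \<open>a\<close> such that it fired \<open>a\<close> time units ago.  A firing of age exactly \<open>\<tau>\<close> is not recorded, because
  its pulse has already been taken into account in the phases.
\<close>

type_synonym state = "(real ^ 3) \<times> (3 \<Rightarrow> real set)"

text \<open>
  In \<open>trajectory b \<epsilon> \<tau> s T x F\<close>, \<open>x u $ i\<close> is the phase of oscillator \<open>i\<close> at time \<open>u\<close>, for
  \<open>0 < u \<le> T\<close>, and \<open>F i\<close> its set of firing times.  The phases of \<open>s\<close> are the right limits at
  time \<open>0\<close>, after all resets at time \<open>0\<close>.
\<close>

definition arrivals :: "real \<Rightarrow> (3 \<Rightarrow> real set) \<Rightarrow> 3 \<Rightarrow> real \<Rightarrow> nat"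
  where "arrivals \<tau> F i t = card {j. j \<noteq> i \<and> t - \<tau> \<in> F j}"

definition trajectory ::
  "real \<Rightarrow> real \<Rightarrow> real \<Rightarrow> state \<Rightarrow> real \<Rightarrow> (real \<Rightarrow> real ^ 3) \<Rightarrow> (3 \<Rightarrow> real set) \<Rightarrow> bool"
  where "trajectory b \<epsilon> \<tau> s T x F \<longleftrightarrow>
    (\<forall>i. F i \<inter> {..0} = uminus ` snd s i \<and>
         finite (F i \<inter> {0<..T}) \<and>
         ((\<lambda>u. x u $ i) \<longlongrightarrow> fst s $ i) (at_right 0) \<and>
         (\<forall>t\<in>{0<..T}. x t $ i \<in> {0..1}) \<and>
         (\<forall>t\<in>{0<..T}. t \<in> F i \<longleftrightarrow> x t $ i = 1) \<and>
         (\<forall>t\<in>{0<..T}. arrivals \<tau> F i t = 0 \<longrightarrow>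
            ((\<lambda>u. x u $ i) \<longlongrightarrow> x t $ i) (at_left t)) \<and>
         (\<forall>t\<in>{0<..T}. arrivals \<tau> F i t \<ge> 1 \<longrightarrow>
            (\<exists>l. ((\<lambda>u. x u $ i) \<longlongrightarrow> l) (at_left t) \<and>
                 x t $ i = min 1 (Hm b \<epsilon> (arrivals \<tau> F i t) l))) \<and>
         (\<forall>t\<in>{0<..<T}.
            ((\<lambda>u. x u $ i) \<longlongrightarrow> (if t \<in> F i then 0 else x t $ i)) (at_right t)) \<and>
         (\<forall>t\<in>{0<..<T}. t \<notin> F i \<and> arrivals \<tau> F i t = 0 \<longrightarrow>
            ((\<lambda>u. x u $ i) has_real_derivative 1) (at t)))"

definition state_after :: "real \<Rightarrow> real \<Rightarrow> (real \<Rightarrow> real ^ 3) \<Rightarrow> (3 \<Rightarrow> real set) \<Rightarrow> state"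
  where "state_after \<tau> t x F =
    ((\<chi> i. if t \<in> F i then 0 else x t $ i), \<lambda>i. {a. 0 \<le> a \<and> a < \<tau> \<and> t - a \<in> F i})"

text \<open>
  The Poincare map of the section on which oscillator 3 has just fired, as a relation between a
  state and its image.
\<close>

definition poincare :: "real \<Rightarrow> real \<Rightarrow> real \<Rightarrow> state \<Rightarrow> state \<Rightarrow> bool"
  where "poincare b \<epsilon> \<tau> s s' \<longleftrightarrow>
    (\<exists>T x F. T > 0 \<and> trajectory b \<epsilon> \<tau> s T x F \<and> T \<in> F 3 \<and> F 3 \<inter> {0<..<T} = {} \<and>
             s' = state_after \<tau> T x F)"

definition orbit :: "real \<Rightarrow> real \<Rightarrow> real \<Rightarrow> state \<Rightarrow> state set"
  where "orbit b \<epsilon> \<tau> s = {s'. (poincare b \<epsilon> \<tau>)\<^sup>*\<^sup>* s s'}"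

definition section_state :: "real ^ 3 \<Rightarrow> real ^ 3 \<Rightarrow> state"
  where "section_state \<theta> \<sigma> = (\<theta>, \<lambda>i. if i = 3 then {0, \<sigma> $ i} else {\<sigma> $ i})"

definition S_phases :: "real \<Rightarrow> real \<Rightarrow> real ^ 3 \<Rightarrow> real ^ 3"
  where "S_phases b \<epsilon> \<sigma> = vector [Hm b \<epsilon> 1 (\<sigma> $ 1), \<sigma> $ 2, 0]"

definition S :: "real \<Rightarrow> real \<Rightarrow> real ^ 3 \<Rightarrow> state"
  where "S b \<epsilon> \<sigma> = section_state (S_phases b \<epsilon> \<sigma>) \<sigma>"

definition F1 :: "real \<Rightarrow> real \<Rightarrow> real \<Rightarrow> real ^ 3 \<Rightarrow> real"
  where "F1 b \<epsilon> \<tau> \<sigma> = Hm b \<epsilon> 1 (\<sigma> $ 1) + \<tau> - \<sigma> $ 3"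

definition F2 :: "real \<Rightarrow> real \<Rightarrow> real \<Rightarrow> real ^ 3 \<Rightarrow> real"
  where "F2 b \<epsilon> \<tau> \<sigma> = Hm b \<epsilon> 1 (\<tau> - \<sigma> $ 3 + \<sigma> $ 2) + \<sigma> $ 3 - \<sigma> $ 1"

definition F3 :: "real \<Rightarrow> real \<Rightarrow> real \<Rightarrow> real ^ 3 \<Rightarrow> real"
  where "F3 b \<epsilon> \<tau> \<sigma> = Hm b \<epsilon> 1 (\<tau> - \<sigma> $ 1) + \<sigma> $ 1 - \<sigma> $ 2"

definition F4 :: "real \<Rightarrow> real \<Rightarrow> real ^ 3 \<Rightarrow> real"
  where "F4 b \<epsilon> \<sigma> = Hm b \<epsilon> 1 (\<sigma> $ 3 - \<sigma> $ 2) + \<sigma> $ 2"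

definition Omega :: "real \<Rightarrow> real \<Rightarrow> real \<Rightarrow> (real ^ 3) set"
  where "Omega b \<epsilon> \<tau> =
    {\<sigma>. 0 < \<sigma> $ 2 \<and> \<sigma> $ 2 < \<sigma> $ 1 \<and> \<sigma> $ 1 < \<sigma> $ 3 \<and> \<sigma> $ 3 < \<tau> \<and>
        F1 b \<epsilon> \<tau> \<sigma> \<in> {Hstar b \<epsilon>..1} \<and> F2 b \<epsilon> \<tau> \<sigma> \<in> {Hstar b \<epsilon>..1} \<and>
        F3 b \<epsilon> \<tau> \<sigma> \<in> {Hstar b \<epsilon>..1} \<and> F4 b \<epsilon> \<sigma> \<in> {Hstar b \<epsilon>..1}}"

text \<open>The states on the section of the orbit with initial state \<open>S b \<epsilon> \<sigma>\<close>.\<close>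

definition Y :: "real \<Rightarrow> real \<Rightarrow> real \<Rightarrow> real ^ 3 \<Rightarrow> state set"
  where "Y b \<epsilon> \<tau> \<sigma> = orbit b \<epsilon> \<tau> (S b \<epsilon> \<sigma>)"

end

theory Submission imports Defs begin

text \<open>
  A pulse carries every phase in \<open>[H\<^sub>*, 1]\<close> to 1.  Starting on the section near IR4, the pulses still
  in transit make oscillators 1, 2, 3 fire in this order, so any small perturbation of the phases is
  forgotten by the time oscillator 3 fires.  The image state therefore depends on \<open>\<sigma>\<close> only: it is
  \<open>S (G \<sigma>)\<close> for an affine map \<open>G\<close> with \<open>G\<^sup>4 = id\<close> that preserves \<open>\<Omega>\<close>.
\<close>

text \<open>Each of \<open>F1\<close>, ..., \<open>F4\<close> is the phase of an oscillator just
  before a pulse reaches it: at most 1, so it has not fired earlier; at least \<open>Hstar\<close>,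
  so it fires on that pulse. After such a firing its phase depends on pulse times alone. Before the
  first return, the initial phases enter only the conditions on \<open>F1\<close> and
  \<open>F2\<close>, since oscillator 3 starts exactly at 0. These two conditions are closed, so
  phase perturbations need some slack in them; it comes from \<sigma> being an interior point. The
  Poincare map is a relation defined through existence of a trajectory. Hence two separate
  arguments: every trajectory up to the first return is forced to have the expected events, and an
  explicit path really is a trajectory.\<close>

section \<open>The pulse map and its absorption threshold\<close>

lemma Hm_one_ge_self:
  assumes "b > 0" "\<epsilon> \<ge> 0" "\<theta> \<ge> 0"
  shows "\<theta> \<le> Hm b \<epsilon> 1 \<theta>"
proof -
  have e: "1 \<le> exp (b * coupling \<epsilon>)"
    using assms by (simp add: coupling_def)
  have "1 * \<theta> \<le> exp (b * coupling \<epsilon>) * \<theta>"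
    using e assms(3) by (rule mult_right_mono)
  moreover have "0 \<le> (exp (b * coupling \<epsilon>) - 1) / (exp b - 1)"
    using e assms(1) by simp
  ultimately show ?thesis by (simp add: Hm_def pulse_def)
qed

lemma Hm_one_mono: "\<theta> \<le> \<theta>' \<Longrightarrow> Hm b \<epsilon> 1 \<theta> \<le> Hm b \<epsilon> 1 \<theta>'"
  by (simp add: Hm_def pulse_def)

lemma Hm_one_ge_one:
  assumes "b > 0" "Hstar b \<epsilon> \<le> \<theta>"
  shows "1 \<le> Hm b \<epsilon> 1 \<theta>"
  using Hm_one_mono[OF assms(2), of b \<epsilon>] Hm_eq_1_iff[OF assms(1), of \<epsilon> "Hstar b \<epsilon>"] by simp

section \<open>Phase pieces of slope 1\<close>

lemma affine_left_limit:
  fixes f :: "real \<Rightarrow> real"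
  assumes "a < t" "\<And>u. a < u \<Longrightarrow> u < t \<Longrightarrow> f u = u + c"
  shows "(f \<longlongrightarrow> t + c) (at_left t)"
proof -
  have "((\<lambda>u. u + c) \<longlongrightarrow> t + c) (at_left t)"
    by (intro tendsto_intros)
  moreover have "\<forall>\<^sub>F u in at_left t. f u = u + c"
    using eventually_at_left_real[OF assms(1)] by eventually_elim (use assms(2) in auto)
  ultimately show ?thesis by (simp add: tendsto_cong)
qed

lemma affine_right_limit:
  fixes f :: "real \<Rightarrow> real"
  assumes "t < a" "\<And>u. t < u \<Longrightarrow> u < a \<Longrightarrow> f u = u + c"
  shows "(f \<longlongrightarrow> t + c) (at_right t)"
proof -
  have "((\<lambda>u. u + c) \<longlongrightarrow> t + c) (at_right t)"
    by (intro tendsto_intros)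
  moreover have "\<forall>\<^sub>F u in at_right t. f u = u + c"
    using eventually_at_right_real[OF assms(1)] by eventually_elim (use assms(2) in auto)
  ultimately show ?thesis by (simp add: tendsto_cong)
qed

lemma affine_derivative:
  fixes f :: "real \<Rightarrow> real"
  assumes "a < t" "t < d" "\<And>u. a < u \<Longrightarrow> u < d \<Longrightarrow> f u = u + c"
  shows "(f has_real_derivative 1) (at t)"
proof -
  have "((\<lambda>u. u + c) has_real_derivative 1) (at t)"
    by (auto intro!: derivative_eq_intros)
  then show ?thesis
    by (rule has_field_derivative_transform_within_open[where S = "{a<..<d}"])
      (use assms in auto)
qed

text \<open>Only a right limit at \<open>a\<close> is assumed: at a firing the recorded value is 1,
  while the motion restarts from 0.\<close>

lemma derivative_one_imp_affine:
  fixes f :: "real \<Rightarrow> real"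
  assumes "\<And>t. a < t \<Longrightarrow> t < c \<Longrightarrow> (f has_real_derivative 1) (at t)"
    and lim: "(f \<longlongrightarrow> v) (at_right a)" and t: "a < t" "t < c"
  shows "f t = t + (v - a)"
proof -
  have "\<exists>k. \<forall>u\<in>{a<..<c}. f u - u = k"
  proof (rule has_field_derivative_zero_constant)
    show "convex {a<..<c}" by simp
    show "((\<lambda>u. f u - u) has_real_derivative 0) (at u within {a<..<c})" if "u \<in> {a<..<c}" for u
      using DERIV_diff[OF assms(1)[of u] DERIV_ident] that
      by (auto intro: has_field_derivative_at_within)
  qed
  then obtain k where k: "\<And>u. a < u \<Longrightarrow> u < c \<Longrightarrow> f u - u = k" by auto
  have "(f \<longlongrightarrow> a + k) (at_right a)"
    by (rule affine_right_limit[where a = c]) (use k t in \<open>auto simp: algebra_simps\<close>)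
  then have "v = a + k"
    using lim tendsto_unique trivial_limit_at_right_real by blast
  with k[OF t] show ?thesis by simp
qed

section \<open>What is forced on an arbitrary trajectory\<close>

text \<open>The phase may reach 1 exactly at \<open>c\<close>, where a pulse may also arrive. Hence
  firing is excluded on the open interval only, and the conclusion at \<open>c\<close> is a left
  limit.\<close>

lemma trajectory_between_arrivals:
  assumes tr: "trajectory b \<epsilon> \<tau> s T x F"
    and "0 \<le> a" "a < c" "c \<le> T"
    and lim: "((\<lambda>u. x u $ i) \<longlongrightarrow> v) (at_right a)"
    and noarr: "\<And>t. a < t \<Longrightarrow> t < c \<Longrightarrow> arrivals \<tau> F i t = 0"
    and le1: "v + (c - a) \<le> 1"
  shows "\<And>t. a < t \<Longrightarrow> t < c \<Longrightarrow> t \<notin> F i"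
    and "((\<lambda>u. x u $ i) \<longlongrightarrow> v + (c - a)) (at_left c)"
proof -
  have fin: "finite (F i \<inter> {0<..T})"
    and fire: "\<And>t. 0 < t \<Longrightarrow> t \<le> T \<Longrightarrow> t \<in> F i \<longleftrightarrow> x t $ i = 1"
    and cont: "\<And>t. 0 < t \<Longrightarrow> t \<le> T \<Longrightarrow> arrivals \<tau> F i t = 0 \<Longrightarrow>
      ((\<lambda>u. x u $ i) \<longlongrightarrow> x t $ i) (at_left t)"
    and deriv: "\<And>t. 0 < t \<Longrightarrow> t < T \<Longrightarrow> t \<notin> F i \<Longrightarrow> arrivals \<tau> F i t = 0 \<Longrightarrow>
      ((\<lambda>u. x u $ i) has_real_derivative 1) (at t)"
    using tr by (auto simp: trajectory_def)
  show nofire: "t \<notin> F i" if "a < t" "t < c" for t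
  proof
    assume "t \<in> F i"
    \<comment> \<open>Finiteness of the firing set yields a first spurious firing \<open>m\<close>.
      The motion is affine up to \<open>m\<close>, so the phase there is still below 1.\<close>
    let ?M = "F i \<inter> {a<..<c}"
    have "finite ?M" by (rule finite_subset[OF _ fin]) (use assms(2,4) in auto)
    moreover have "?M \<noteq> {}" using \<open>t \<in> F i\<close> that by auto
    ultimately have M: "Min ?M \<in> ?M" "\<And>u. u \<in> ?M \<Longrightarrow> Min ?M \<le> u"
      using Min_in Min_le by blast+
    define m where "m = Min ?M"
    have m: "m \<in> F i" "a < m" "m < c" and first: "\<And>u. a < u \<Longrightarrow> u < m \<Longrightarrow> u \<notin> F i"
      using M unfolding m_def[symmetric] by force+
    have d: "((\<lambda>u. x u $ i) has_real_derivative 1) (at u)" if "a < u" "u < m" for u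
      by (rule deriv) (use that m assms(2-4) noarr first in auto)
    have "((\<lambda>u. x u $ i) \<longlongrightarrow> m + (v - a)) (at_left m)"
      by (rule affine_left_limit[OF m(2)]) (rule derivative_one_imp_affine[OF d lim])
    moreover have "((\<lambda>u. x u $ i) \<longlongrightarrow> x m $ i) (at_left m)"
      by (rule cont) (use m assms(2-4) noarr in auto)
    ultimately have "x m $ i = m + (v - a)"
      using tendsto_unique trivial_limit_at_left_real by blast
    moreover have "x m $ i = 1" using fire[of m] m assms(2-4) by auto
    ultimately show False using m le1 by simp
  qed
  have d: "((\<lambda>u. x u $ i) has_real_derivative 1) (at u)" if "a < u" "u < c" for u
    by (rule deriv) (use that assms(2-4) noarr nofire in auto)
  have "((\<lambda>u. x u $ i) \<longlongrightarrow> c + (v - a)) (at_left c)"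
    by (rule affine_left_limit[OF \<open>a < c\<close>]) (rule derivative_one_imp_affine[OF d lim])
  then show "((\<lambda>u. x u $ i) \<longlongrightarrow> v + (c - a)) (at_left c)" by (simp add: algebra_simps)
qed

text \<open>Uniqueness of limits identifies the existential left limit in \<open>trajectory\<close>
  with \<open>l\<close>. Multiplicities 0 and 1 are the ones that occur near IR4 up to the
  return.\<close>

lemma trajectory_arrival:
  assumes tr: "trajectory b \<epsilon> \<tau> s T x F" and "0 < t" "t \<le> T"
    and lim: "((\<lambda>u. x u $ i) \<longlongrightarrow> l) (at_left t)"
  shows "arrivals \<tau> F i t = 0 \<Longrightarrow> x t $ i = l"
    and "arrivals \<tau> F i t = 1 \<Longrightarrow> x t $ i = min 1 (Hm b \<epsilon> 1 l)"
proof -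
  show "x t $ i = l" if "arrivals \<tau> F i t = 0"
  proof -
    have "((\<lambda>u. x u $ i) \<longlongrightarrow> x t $ i) (at_left t)"
      using tr that assms(2,3) by (auto simp: trajectory_def)
    then show ?thesis using lim tendsto_unique trivial_limit_at_left_real by blast
  qed
  show "x t $ i = min 1 (Hm b \<epsilon> 1 l)" if arr: "arrivals \<tau> F i t = 1"
  proof -
    have "\<forall>t\<in>{0<..T}. arrivals \<tau> F i t \<ge> 1 \<longrightarrow>
            (\<exists>l. ((\<lambda>u. x u $ i) \<longlongrightarrow> l) (at_left t) \<and>
                 x t $ i = min 1 (Hm b \<epsilon> (arrivals \<tau> F i t) l))"
      using tr by (simp add: trajectory_def)
    then have "\<exists>l. ((\<lambda>u. x u $ i) \<longlongrightarrow> l) (at_left t) \<and>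
                 x t $ i = min 1 (Hm b \<epsilon> (arrivals \<tau> F i t) l)"
      using assms(2,3) arr by (metis greaterThanAtMost_iff order_refl)
    then obtain l' where l': "((\<lambda>u. x u $ i) \<longlongrightarrow> l') (at_left t)"
        "x t $ i = min 1 (Hm b \<epsilon> 1 l')"
      unfolding arr by blast
    moreover have "l' = l" using l'(1) lim tendsto_unique trivial_limit_at_left_real by blast
    ultimately show ?thesis by simp
  qed
qed

lemma trajectory_reset:
  assumes "trajectory b \<epsilon> \<tau> s T x F" "0 < t" "t < T"
  shows "((\<lambda>u. x u $ i) \<longlongrightarrow> (if t \<in> F i then 0 else x t $ i)) (at_right t)"
proof -
  have "\<forall>t\<in>{0<..<T}. ((\<lambda>u. x u $ i) \<longlongrightarrow> (if t \<in> F i then 0 else x t $ i)) (at_right t)"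
    using assms(1) unfolding trajectory_def by blast
  then show ?thesis using assms(2,3) by (rule_tac bspec) auto
qed

lemma trajectory_initial:
  assumes "trajectory b \<epsilon> \<tau> s T x F"
  shows "((\<lambda>u. x u $ i) \<longlongrightarrow> fst s $ i) (at_right 0)" "F i \<inter> {..0} = uminus ` snd s i"
  using assms by (simp_all add: trajectory_def)

lemma trajectory_fires_iff:
  assumes "trajectory b \<epsilon> \<tau> s T x F" "0 < t" "t \<le> T"
  shows "t \<in> F i \<longleftrightarrow> x t $ i = 1"
  using assms by (simp add: trajectory_def)

section \<open>Building a trajectory from affine pieces\<close>

text \<open>Reduces the limits and derivatives in \<open>trajectory\<close> to arithmetic at three
  event times. The \<open>c0\<close>, \<open>c1\<close>, \<open>c2\<close> are intercepts:
  \<open>t1 + c0 i\<close> and \<open>t1 + c1 i\<close> are the left and right limits at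
  \<open>t1\<close>, and so on.\<close>

lemma trajectory_three_piecesI:
  fixes x :: "real \<Rightarrow> real ^ 3" and c0 c1 c2 :: "3 \<Rightarrow> real"
  assumes t: "0 < t1" "t1 < t2" "t2 < t3"
    and past: "\<And>i. F i \<inter> {..0} = uminus ` snd s i"
    and future: "\<And>i. F i \<inter> {0<..} \<subseteq> {t1, t2, t3}"
    and noarr: "\<And>i u. 0 < u \<Longrightarrow> u < t3 \<Longrightarrow> u \<noteq> t1 \<Longrightarrow> u \<noteq> t2 \<Longrightarrow> arrivals \<tau> F i u = 0"
    and c0: "\<And>i. c0 i = fst s $ i"
    and x0: "\<And>i u. 0 < u \<Longrightarrow> u < t1 \<Longrightarrow> x u $ i = u + c0 i"
    and x1: "\<And>i u. t1 < u \<Longrightarrow> u < t2 \<Longrightarrow> x u $ i = u + c1 i"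
    and x2: "\<And>i u. t2 < u \<Longrightarrow> u < t3 \<Longrightarrow> x u $ i = u + c2 i"
    and bounds: "\<And>i. 0 \<le> c0 i \<and> t1 + c0 i \<le> 1" "\<And>i. 0 \<le> t1 + c1 i \<and> t2 + c1 i \<le> 1"
      "\<And>i. 0 \<le> t2 + c2 i \<and> t3 + c2 i \<le> 1"
    and range: "\<And>i. x t1 $ i \<in> {0..1}" "\<And>i. x t2 $ i \<in> {0..1}" "\<And>i. x t3 $ i \<in> {0..1}"
    and fire: "\<And>i. t1 \<in> F i \<longleftrightarrow> x t1 $ i = 1" "\<And>i. t2 \<in> F i \<longleftrightarrow> x t2 $ i = 1"
      "\<And>i. t3 \<in> F i \<longleftrightarrow> x t3 $ i = 1"
    and jump: "\<And>i. x t1 $ i = (if arrivals \<tau> F i t1 = 0 then t1 + c0 i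
                 else min 1 (Hm b \<epsilon> (arrivals \<tau> F i t1) (t1 + c0 i)))"
      "\<And>i. x t2 $ i = (if arrivals \<tau> F i t2 = 0 then t2 + c1 i
                 else min 1 (Hm b \<epsilon> (arrivals \<tau> F i t2) (t2 + c1 i)))"
      "\<And>i. x t3 $ i = (if arrivals \<tau> F i t3 = 0 then t3 + c2 i
                 else min 1 (Hm b \<epsilon> (arrivals \<tau> F i t3) (t3 + c2 i)))"
    and reset: "\<And>i. t1 + c1 i = (if t1 \<in> F i then 0 else x t1 $ i)"
      "\<And>i. t2 + c2 i = (if t2 \<in> F i then 0 else x t2 $ i)"
  shows "trajectory b \<epsilon> \<tau> s t3 x F"
proof -
  \<comment> \<open>An elimination rule shared by several clauses below: a time lies inside an
    affine piece with its phase bounds, or is an event time.\<close>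
  have pieces: thesis
    if u: "u \<in> {0<..t3}" and affine:
      "\<And>p q c. 0 \<le> p \<Longrightarrow> p < u \<Longrightarrow> u < q \<Longrightarrow> 0 \<le> p + c i \<Longrightarrow> q + c i \<le> 1 \<Longrightarrow>
        (\<And>u. p < u \<Longrightarrow> u < q \<Longrightarrow> x u $ i = u + c i) \<Longrightarrow> u \<noteq> t1 \<Longrightarrow> u \<noteq> t2 \<Longrightarrow> u \<noteq> t3 \<Longrightarrow> thesis"
      and at_event: "u = t1 \<Longrightarrow> thesis" "u = t2 \<Longrightarrow> thesis" "u = t3 \<Longrightarrow> thesis" for u i thesis
  proof -
    consider "u < t1" | "u = t1" | "t1 < u" "u < t2" | "u = t2" | "t2 < u" "u < t3" | "u = t3"
      using u by fastforce
    then show ?thesis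
    proof cases
      case 1 then show ?thesis
        using u affine[of 0 t1 c0] bounds(1)[of i] x0 t by auto
    next
      case 3 then show ?thesis
        using affine[of t1 t2 c1] bounds(2)[of i] x1 t by auto
    next
      case 5 then show ?thesis
        using affine[of t2 t3 c2] bounds(3)[of i] x2 t by auto
    qed (use at_event in auto)
  qed
  have left: "((\<lambda>u. x u $ i) \<longlongrightarrow> t1 + c0 i) (at_left t1)"
    "((\<lambda>u. x u $ i) \<longlongrightarrow> t2 + c1 i) (at_left t2)"
    "((\<lambda>u. x u $ i) \<longlongrightarrow> t3 + c2 i) (at_left t3)" for i
    using affine_left_limit[OF t(1) x0] affine_left_limit[OF t(2) x1]
      affine_left_limit[OF t(3) x2] by auto
  have right: "((\<lambda>u. x u $ i) \<longlongrightarrow> 0 + c0 i) (at_right 0)"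
    "((\<lambda>u. x u $ i) \<longlongrightarrow> t1 + c1 i) (at_right t1)"
    "((\<lambda>u. x u $ i) \<longlongrightarrow> t2 + c2 i) (at_right t2)" for i
    using affine_right_limit[OF t(1) x0] affine_right_limit[OF t(2) x1]
      affine_right_limit[OF t(3) x2] by auto
  have nofire: "u \<notin> F i" if "0 < u" "u \<noteq> t1" "u \<noteq> t2" "u \<noteq> t3" for u i
    using future[of i] that by auto
  have G1: "finite (F i \<inter> {0<..t3})" for i
    by (rule finite_subset[of _ "{t1, t2, t3}"]) (use future[of i] in auto)
  have G2: "x u $ i \<in> {0..1} \<and> (u \<in> F i \<longleftrightarrow> x u $ i = 1)" if "u \<in> {0<..t3}" for u i
  proof (rule pieces[OF that, where i = i])
    fix p q c
    assume *: "0 \<le> p" "p < u" "u < q" "0 \<le> p + c i" "q + c i \<le> 1"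
        "\<And>u. p < u \<Longrightarrow> u < q \<Longrightarrow> x u $ i = u + c i" "u \<noteq> t1" "u \<noteq> t2" "u \<noteq> t3"
    then show ?thesis using nofire[of u i] by auto
  qed (use range fire in auto)
  have G3: "((\<lambda>u. x u $ i) \<longlongrightarrow> x u $ i) (at_left u)"
    if "u \<in> {0<..t3}" "arrivals \<tau> F i u = 0" for u i
  proof (rule pieces[OF that(1), where i = i])
    fix p q c
    assume *: "0 \<le> p" "p < u" "u < q" "0 \<le> p + c i" "q + c i \<le> 1"
        "\<And>u. p < u \<Longrightarrow> u < q \<Longrightarrow> x u $ i = u + c i" "u \<noteq> t1" "u \<noteq> t2" "u \<noteq> t3"
    then show ?thesis using affine_left_limit[of p u "\<lambda>u. x u $ i" "c i"] by auto
  qed (use left jump that in auto)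
  have G4: "\<exists>l. ((\<lambda>u. x u $ i) \<longlongrightarrow> l) (at_left u) \<and>
                 x u $ i = min 1 (Hm b \<epsilon> (arrivals \<tau> F i u) l)"
    if u: "u \<in> {0<..t3}" "arrivals \<tau> F i u \<ge> 1" for u i
  proof -
    consider "u = t1" | "u = t2" | "u = t3"
      using noarr[of u i] u by fastforce
    then show ?thesis
      using left[of i] jump[of i] u by cases auto
  qed
  have G5: "((\<lambda>u. x u $ i) \<longlongrightarrow> (if u \<in> F i then 0 else x u $ i)) (at_right u)"
    if "u \<in> {0<..<t3}" for u i
  proof -
    have "u \<in> {0<..t3}" using that by auto
    then show ?thesis
    proof (rule pieces[where i = i])
      fix p q c
      assume *: "0 \<le> p" "p < u" "u < q" "0 \<le> p + c i" "q + c i \<le> 1"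
          "\<And>u. p < u \<Longrightarrow> u < q \<Longrightarrow> x u $ i = u + c i" "u \<noteq> t1" "u \<noteq> t2" "u \<noteq> t3"
      then show ?thesis
        using affine_right_limit[of u q "\<lambda>u. x u $ i" "c i"] nofire[of u i] by auto
    next
      assume "u = t1"
      show ?thesis using right(2)[of i] unfolding reset(1) \<open>u = t1\<close> .
    next
      assume "u = t2"
      show ?thesis using right(3)[of i] unfolding reset(2) \<open>u = t2\<close> .
    qed (use that in auto)
  qed
  have G6: "((\<lambda>u. x u $ i) has_real_derivative 1) (at u)"
    if "u \<in> {0<..<t3}" "u \<notin> F i" "arrivals \<tau> F i u = 0" for u i
  proof -
    have deriv: ?thesis if "p < u" "u < q" "\<And>u. p < u \<Longrightarrow> u < q \<Longrightarrow> x u $ i = u + c" for p q c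
      using affine_derivative[OF that] .
    \<comment> \<open>An event for one oscillator may be an ordinary moment for another. Without
      firing or arrival, \<open>jump\<close> and \<open>reset\<close> force equal intercepts, so the
      two pieces form one line.\<close>
    have t1': ?thesis if "u = t1"
    proof (rule deriv[where p = 0 and q = t2 and c = "c0 i"])
      have "c1 i = c0 i" "x t1 $ i = t1 + c0 i"
        using reset(1)[of i] jump(1)[of i] that \<open>u \<notin> F i\<close> \<open>arrivals \<tau> F i u = 0\<close> by auto
      then show "x v $ i = v + c0 i" if "0 < v" "v < t2" for v
        using that x0[of v i] x1[of v i] by (cases v t1 rule: linorder_cases) auto
    qed (use that t in auto)
    have t2': ?thesis if "u = t2"
    proof (rule deriv[where p = t1 and q = t3 and c = "c1 i"])
      have "c2 i = c1 i" "x t2 $ i = t2 + c1 i"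
        using reset(2)[of i] jump(2)[of i] that \<open>u \<notin> F i\<close> \<open>arrivals \<tau> F i u = 0\<close> by auto
      then show "x v $ i = v + c1 i" if "t1 < v" "v < t3" for v
        using that x1[of v i] x2[of v i] by (cases v t2 rule: linorder_cases) auto
    qed (use that t in auto)
    have "u \<in> {0<..t3}" using \<open>u \<in> {0<..<t3}\<close> by auto
    then show ?thesis
      by (rule pieces[where i = i]) (use deriv t1' t2' \<open>u \<in> {0<..<t3}\<close> in auto)
  qed
  show ?thesis
    unfolding trajectory_def using past G1 right(1) c0 G2 G3 G4 G5 G6 by auto
qed


section \<open>The return map on firing ages\<close>

text \<open>Ages seen at the return time \<open>\<tau> - \<sigma> $ 2\<close> of the firings of
  oscillators 1, 2, 3 at times \<open>\<tau> - \<sigma> $ 3\<close>,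
  \<open>\<tau> - \<sigma> $ 1\<close> and 0.\<close>

definition G :: "real \<Rightarrow> real ^ 3 \<Rightarrow> real ^ 3"
  where "G \<tau> \<sigma> = vector [\<sigma> $ 3 - \<sigma> $ 2, \<sigma> $ 1 - \<sigma> $ 2, \<tau> - \<sigma> $ 2]"

lemma G_nth [simp]:
  "G \<tau> \<sigma> $ 1 = \<sigma> $ 3 - \<sigma> $ 2" "G \<tau> \<sigma> $ 2 = \<sigma> $ 1 - \<sigma> $ 2" "G \<tau> \<sigma> $ 3 = \<tau> - \<sigma> $ 2"
  by (simp_all add: G_def)

text \<open>The gaps \<open>\<sigma> $ 2\<close>, \<open>\<sigma> $ 1 - \<sigma> $ 2\<close>,
  \<open>\<sigma> $ 3 - \<sigma> $ 1\<close>, \<open>\<tau> - \<sigma> $ 3\<close> add up to \<tau>,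
  and \<open>G \<tau>\<close> shifts them cyclically.\<close>

lemma G_funpow_4: "(G \<tau> ^^ 4) \<sigma> = \<sigma>"
  by (simp add: vec_eq_iff forall_3 eval_nat_numeral)

text \<open>Composition with \<^term>\<open>G \<tau>\<close> permutes the four functions \<open>F\<^sub>k\<close> cyclically.\<close>

lemma G_Omega: "\<sigma> \<in> Omega b \<epsilon> \<tau> \<Longrightarrow> G \<tau> \<sigma> \<in> Omega b \<epsilon> \<tau>"
  by (auto simp: Omega_def F1_def F2_def F3_def F4_def algebra_simps)

section \<open>The first return from a state near IR4\<close>

text \<open>Here \<theta> is not tied to \<sigma>, so perturbed states are covered.
  \<open>fires_1\<close> and \<open>fires_2\<close> are the conditions on \<open>F1\<close> and
  \<open>F2\<close> with \<open>Hm b \<epsilon> 1 (\<sigma> $ 1)\<close> and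
  \<open>\<sigma> $ 2\<close> replaced by the actual phases. \<open>F4_le\<close> keeps oscillator 1
  from firing on the pulse at the return.\<close>

locale near_IR4 =
  fixes b \<epsilon> \<tau> :: real and \<theta> \<sigma> :: "real ^ 3"
  assumes b: "b > 0" and eps: "\<epsilon> \<ge> 0"
    and order: "0 < \<sigma> $ 2" "\<sigma> $ 2 < \<sigma> $ 1" "\<sigma> $ 1 < \<sigma> $ 3" "\<sigma> $ 3 < \<tau>"
    and phases: "0 \<le> \<theta> $ 1" "0 \<le> \<theta> $ 2" "\<theta> $ 3 = 0"
    and fires_1: "\<theta> $ 1 + (\<tau> - \<sigma> $ 3) \<in> {Hstar b \<epsilon>..1}"
    and fires_2: "Hm b \<epsilon> 1 (\<theta> $ 2 + (\<tau> - \<sigma> $ 3)) + (\<sigma> $ 3 - \<sigma> $ 1) \<in> {Hstar b \<epsilon>..1}"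
    and fires_3: "F3 b \<epsilon> \<tau> \<sigma> \<in> {Hstar b \<epsilon>..1}"
    and F4_le: "F4 b \<epsilon> \<sigma> \<le> 1"
begin

abbreviation h :: "real \<Rightarrow> real" where "h \<equiv> Hm b \<epsilon> 1"
text \<open>Arrival times of the pulses sent before time 0 by oscillators 3, 1, 2, in this order.
  The pulse sent at time 0 arrives at \<tau>, after \<open>t3\<close>.\<close>

abbreviation t1 :: real where "t1 \<equiv> \<tau> - \<sigma> $ 3"
abbreviation t2 :: real where "t2 \<equiv> \<tau> - \<sigma> $ 1"
abbreviation t3 :: real where "t3 \<equiv> \<tau> - \<sigma> $ 2"

definition has_past :: "(3 \<Rightarrow> real set) \<Rightarrow> bool"
  where "has_past F \<longleftrightarrow> (\<forall>i. F i \<inter> {..0} = uminus ` snd (section_state \<theta> \<sigma>) i)"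

text \<open>\<open>t < \<tau>\<close> makes \<open>t - \<tau>\<close> negative, which leaves out the
  firing of oscillator 3 at time 0.\<close>

lemma past_firing_iff:
  assumes "has_past F" "0 < t" "t < \<tau>"
  shows "t - \<tau> \<in> F j \<longleftrightarrow> t = \<tau> - \<sigma> $ j"
proof -
  have "t - \<tau> \<in> F j \<longleftrightarrow> t - \<tau> \<in> F j \<inter> {..0}"
    using assms by auto
  also have "\<dots> \<longleftrightarrow> t = \<tau> - \<sigma> $ j"
    using assms unfolding has_past_def by (auto simp: section_state_def)
  finally show ?thesis .
qed

lemma arrivals_eq_0:
  assumes "has_past F" "0 < t" "t < \<tau>" "\<And>j. j \<noteq> i \<Longrightarrow> t \<noteq> \<tau> - \<sigma> $ j"
  shows "arrivals \<tau> F i t = 0"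
  using past_firing_iff[OF assms(1-3)] assms(4) by (auto simp: arrivals_def)

text \<open>The three ages are distinct, so only the pulse of \<open>j\<close> lands at this time,
  and its sender does not receive it.\<close>

lemma arrivals_at:
  assumes "has_past F"
  shows "arrivals \<tau> F i (\<tau> - \<sigma> $ j) = (if i = j then 0 else 1)"
proof -
  have inj: "\<sigma> $ j = \<sigma> $ k \<longleftrightarrow> j = k" and "0 < \<sigma> $ j" "\<sigma> $ j < \<tau>" for k
    using order exhaust_3[of j] exhaust_3[of k] by auto
  then have "\<tau> - \<sigma> $ j - \<tau> \<in> F k \<longleftrightarrow> k = j" for k
    using past_firing_iff[OF assms, of "\<tau> - \<sigma> $ j" k] inj[of k] by auto
  then have "{k. k \<noteq> i \<and> \<tau> - \<sigma> $ j - \<tau> \<in> F k} = {j} - {i}"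
    by auto
  then show ?thesis by (simp add: arrivals_def)
qed

lemma no_arrivals:
  assumes "has_past F" "0 < t" "t < t3" "t \<noteq> t1" "t \<noteq> t2"
  shows "arrivals \<tau> F i t = 0"
proof (rule arrivals_eq_0[OF assms(1,2)])
  show "t < \<tau>" using assms(3) order by simp
  show "t \<noteq> \<tau> - \<sigma> $ j" for j using assms exhaust_3[of j] by auto
qed

text \<open>Strictness comes from the positive waiting times
  \<open>\<sigma> $ 3 - \<sigma> $ 1\<close>, \<open>\<sigma> $ 1 - \<sigma> $ 2\<close> and
  \<open>\<sigma> $ 2\<close> that are added to these values in conditions bounded by 1.\<close>

lemma bounds:
  "\<theta> $ 2 + t1 \<le> h (\<theta> $ 2 + t1)" "h (\<theta> $ 2 + t1) < 1"
  "t2 \<le> h t2" "h t2 < 1"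
  "t3 - t1 \<le> h (t3 - t1)" "h (t3 - t1) < 1"
  using Hm_one_ge_self[OF b eps, of "\<theta> $ 2 + t1"] Hm_one_ge_self[OF b eps, of t2]
    Hm_one_ge_self[OF b eps, of "t3 - t1"] order phases fires_2 fires_3 F4_le
  by (auto simp: F3_def F4_def)

lemma absorbed_pulses:
  "1 \<le> h (\<theta> $ 1 + t1)" "1 \<le> h (h (\<theta> $ 2 + t1) + (t2 - t1))" "1 \<le> h (h t2 + (t3 - t2))"
  by (rule Hm_one_ge_one[OF b]; use fires_1 fires_2 fires_3 in \<open>simp add: F3_def\<close>)+

text \<open>The forced half of the return argument. Oscillator 3 is followed first because it
  determines \<open>T\<close>; then oscillators 1 and 2 can be traced up to
  \<open>t3\<close>.\<close>

lemma trajectory_on_section: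
  assumes tr: "trajectory b \<epsilon> \<tau> (section_state \<theta> \<sigma>) T x F"
    and "0 < T" "T \<in> F 3" "F 3 \<inter> {0<..<T} = {}"
  shows "T = t3"
    and "x t3 $ 1 = h (t3 - t1)" "x t3 $ 2 = t3 - t2"
    and "F 1 \<inter> {..t3} = {- \<sigma> $ 1, t1}" "F 2 \<inter> {..t3} = {- \<sigma> $ 2, t2}"
      "F 3 \<inter> {..t3} = {- \<sigma> $ 3, 0, t3}"
proof -
  note bt = trajectory_between_arrivals[OF tr]
  note jump = trajectory_arrival[OF tr]
  note fires = trajectory_fires_iff[OF tr]
  note reset = trajectory_reset[OF tr]
  have past: "has_past F"
    using trajectory_initial(2)[OF tr] by (simp add: has_past_def)
  note at = arrivals_at[OF past]
  have init: "((\<lambda>u. x u $ i) \<longlongrightarrow> \<theta> $ i) (at_right 0)" for i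
    using trajectory_initial(1)[OF tr] by (simp add: section_state_def)
  have init3: "((\<lambda>u. x u $ 3) \<longlongrightarrow> 0) (at_right 0)"
    using init[of 3] phases(3) by simp
  \<comment> \<open>The pulse landing at \<open>t1\<close> is oscillator 3's own, so nothing
    interrupts it before \<open>t2\<close>.\<close>
  have none3: "arrivals \<tau> F 3 t = 0" if "0 < t" "t < t2" for t
  proof (rule arrivals_eq_0[OF past])
    show "t \<noteq> \<tau> - \<sigma> $ j" if "j \<noteq> 3" for j
      using \<open>t < t2\<close> order exhaust_3[of j] that by auto
  qed (use that order in auto)
  have "x T $ 3 = 1" using fires[of T 3] assms by simp
  have "t2 < T"
  proof (rule ccontr)
    assume "\<not> t2 < T"
    then have "T \<le> t2" by simp
    then have left: "((\<lambda>u. x u $ 3) \<longlongrightarrow> 0 + (T - 0)) (at_left T)"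
      using \<open>0 < T\<close> bounds(3,4) by (intro bt(2)[OF _ _ _ init3]) (auto intro: none3)
    show False
    proof (cases "T = t2")
      case True
      then have "x T $ 3 = min 1 (h T)"
        using jump(2)[OF \<open>0 < T\<close> order_refl left] at[of 3 1] by simp
      then show False using \<open>x T $ 3 = 1\<close> True bounds(4) by simp
    next
      case False
      then have "arrivals \<tau> F 3 T = 0"
        using \<open>T \<le> t2\<close> \<open>0 < T\<close> by (intro none3) auto
      then have "x T $ 3 = T"
        using jump(1)[OF \<open>0 < T\<close> order_refl left] by simp
      then show False using \<open>x T $ 3 = 1\<close> \<open>T \<le> t2\<close> bounds(3,4) by simp
    qed
  qed
  have pos: "0 < t1" "t1 < t2" "t2 < t3" using order by auto
  have left3: "((\<lambda>u. x u $ 3) \<longlongrightarrow> 0 + (t2 - 0)) (at_left t2)"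
    using pos \<open>t2 < T\<close> bounds(3,4) by (intro bt(2)[OF _ _ _ init3]) (auto intro: none3)
  have "x t2 $ 3 = h t2"
    using jump(2)[OF _ _ left3] at[of 3 1] bounds(4) pos \<open>t2 < T\<close> by simp
  then have right3: "((\<lambda>u. x u $ 3) \<longlongrightarrow> h t2) (at_right t2)"
    using reset[of t2 3] fires[of t2 3] bounds(4) pos \<open>t2 < T\<close> by simp
  have F3_le: "h t2 + (t3 - t2) \<le> 1"
    using fires_3 by (simp add: F3_def)
  have left3': "((\<lambda>u. x u $ 3) \<longlongrightarrow> h t2 + (c - t2)) (at_left c)" if "t2 < c" "c \<le> T" "c \<le> t3" for c
    using that F3_le pos
    by (intro bt(2)[OF _ _ _ right3]) (auto intro!: no_arrivals[OF past])
  \<comment> \<open>A return before \<open>t3\<close> would need a phase below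
    \<open>h t2 + (t3 - t2) \<le> 1\<close> to equal 1. A return after \<open>t3\<close> would skip
    the firing forced by the pulse at \<open>t3\<close>.\<close>
  show "T = t3"
  proof (rule linorder_cases)
    assume "T < t3"
    then have "arrivals \<tau> F 3 T = 0"
      using \<open>t2 < T\<close> pos by (intro no_arrivals[OF past]) auto
    then have "x T $ 3 = h t2 + (T - t2)"
      using jump(1)[OF \<open>0 < T\<close> order_refl left3'] \<open>t2 < T\<close> \<open>T < t3\<close> by simp
    then show ?thesis using \<open>x T $ 3 = 1\<close> F3_le \<open>T < t3\<close> by simp
  next
    assume "t3 < T"
    then have "x t3 $ 3 = 1"
      using jump(2)[OF _ _ left3', of t3] at[of 3 2] pos absorbed_pulses(3) by simp
    then have "t3 \<in> F 3 \<inter> {0<..<T}" using fires[of t3 3] pos \<open>t3 < T\<close> by simp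
    then show ?thesis using assms(4) by blast
  qed
  then have T: "t1 \<le> T" "t1 < T" "t2 \<le> T" "t2 < T" "t3 \<le> T" "0 < t2" "0 < t3" "t1 < t3"
    using pos by auto

  have a0: "\<And>t. 0 < t \<Longrightarrow> t < t1 \<Longrightarrow> arrivals \<tau> F i t = 0"
    and a1: "\<And>t. t1 < t \<Longrightarrow> t < t2 \<Longrightarrow> arrivals \<tau> F i t = 0"
    and a2: "\<And>t. t2 < t \<Longrightarrow> t < t3 \<Longrightarrow> arrivals \<tau> F i t = 0" for i
    using pos by (auto intro!: no_arrivals[OF past])

  have le: "\<theta> $ 1 + (t1 - 0) \<le> 1" using fires_1 by simp
  note A0 = bt[OF order_refl pos(1) T(1) init a0 le]
  \<comment> \<open>Here \<open>\<theta> $ 1\<close> is forgotten.\<close>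
  have x11: "x t1 $ 1 = 1"
    using jump(2)[OF pos(1) T(1) A0(2)] at[of 1 3] absorbed_pulses(1) by simp
  then have f11: "t1 \<in> F 1" using fires[of t1 1] pos T by simp
  have r1: "((\<lambda>u. x u $ 1) \<longlongrightarrow> 0) (at_right t1)"
    using reset[of t1 1] f11 pos T by simp
  \<comment> \<open>The pulse at \<open>t2\<close> is oscillator 1's own, so one piece runs from
    \<open>t1\<close> to \<open>t3\<close>.\<close>
  have a12: "arrivals \<tau> F 1 t = 0" if "t1 < t" "t < t3" for t
    using a1[of t] a2[of t] at[of 1 1] that by (cases t t2 rule: linorder_cases) auto
  have le: "0 + (t3 - t1) \<le> 1" using bounds(5,6) by simp
  note A1 = bt[OF less_imp_le[OF pos(1)] T(8) T(5) r1 a12 le]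
  show x13: "x t3 $ 1 = h (t3 - t1)"
    using jump(2)[OF T(7) T(5) A1(2)] at[of 1 2] bounds(6) by simp
  then have f13: "t3 \<notin> F 1" using fires[of t3 1] T bounds(6) by simp

  have le: "\<theta> $ 2 + (t1 - 0) \<le> 1" using bounds(1,2) by simp
  note B0 = bt[OF order_refl pos(1) T(1) init a0 le]
  have x21: "x t1 $ 2 = h (\<theta> $ 2 + t1)"
    using jump(2)[OF pos(1) T(1) B0(2)] at[of 2 3] bounds(2) by simp
  then have f21: "t1 \<notin> F 2" using fires[of t1 2] pos T bounds(2) by simp
  have r2: "((\<lambda>u. x u $ 2) \<longlongrightarrow> h (\<theta> $ 2 + t1)) (at_right t1)"
    using reset[of t1 2] f21 x21 pos T by simp
  have le: "h (\<theta> $ 2 + t1) + (t2 - t1) \<le> 1" using fires_2 by simp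
  note B1 = bt[OF less_imp_le[OF pos(1)] pos(2) T(3) r2 a1 le]
  \<comment> \<open>Here \<open>\<theta> $ 2\<close>, still present in the phase after
    \<open>t1\<close>, is forgotten too.\<close>
  have x22: "x t2 $ 2 = 1"
    using jump(2)[OF T(6) T(3) B1(2)] at[of 2 1] absorbed_pulses(2) by simp
  then have f22: "t2 \<in> F 2" using fires[of t2 2] T by simp
  have r2: "((\<lambda>u. x u $ 2) \<longlongrightarrow> 0) (at_right t2)"
    using reset[of t2 2] f22 T by simp
  have lt: "t3 - t2 < 1" using bounds(5,6) pos by simp
  then have le: "0 + (t3 - t2) \<le> 1" by simp
  note B2 = bt[OF less_imp_le[OF T(6)] pos(3) T(5) r2 a2 le]
  \<comment> \<open>Oscillator 2 passes \<open>t3\<close> without a jump, the pulse there being its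
    own.\<close>
  show x23: "x t3 $ 2 = t3 - t2"
    using jump(1)[OF T(7) T(5) B2(2)] at[of 2 2] by simp
  then have f23: "t3 \<notin> F 2" using fires[of t3 2] T lt by simp

  have F_past: "F i \<inter> {..0} = uminus ` (if i = 3 then {0, \<sigma> $ i} else {\<sigma> $ i})" for i
    using trajectory_initial(2)[OF tr, of i] by (simp add: section_state_def)
  have split: "F i \<inter> {..t3} = (F i \<inter> {..0}) \<union> (F i \<inter> {0<..t3})" for i
    using T(7) by auto
  have "F 1 \<inter> {0<..t3} = {t1}"
  proof (intro equalityI subsetI)
    fix t assume "t \<in> F 1 \<inter> {0<..t3}"
    then show "t \<in> {t1}"
      using A0(1)[of t] A1(1)[of t] f13 by (cases t t1 rule: linorder_cases; cases "t = t3") auto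
  qed (use f11 T pos in auto)
  then show "F 1 \<inter> {..t3} = {- \<sigma> $ 1, t1}"
    unfolding split F_past by auto
  have "F 2 \<inter> {0<..t3} = {t2}"
  proof (intro equalityI subsetI)
    fix t assume "t \<in> F 2 \<inter> {0<..t3}"
    then show "t \<in> {t2}"
      using B0(1)[of t] B1(1)[of t] B2(1)[of t] f21 f23
      by (cases t t1 rule: linorder_cases; cases t t2 rule: linorder_cases; cases "t = t3") auto
  qed (use f22 T pos in auto)
  then show "F 2 \<inter> {..t3} = {- \<sigma> $ 2, t2}"
    unfolding split F_past by auto
  have "F 3 \<inter> {0<..t3} = {t3}"
    using assms(3,4) T(7) unfolding \<open>T = t3\<close> by force
  then show "F 3 \<inter> {..t3} = {- \<sigma> $ 3, 0, t3}"
    unfolding split F_past by auto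
qed

lemma state_after_eq_S_G:
  assumes x: "x t3 $ 1 = h (t3 - t1)" "x t3 $ 2 = t3 - t2"
    and F: "F 1 \<inter> {..t3} = {- \<sigma> $ 1, t1}" "F 2 \<inter> {..t3} = {- \<sigma> $ 2, t2}"
      "F 3 \<inter> {..t3} = {- \<sigma> $ 3, 0, t3}"
  shows "state_after \<tau> t3 x F = S b \<epsilon> (G \<tau> \<sigma>)"
proof -
  have "t3 - a \<in> F i \<longleftrightarrow> t3 - a \<in> F i \<inter> {..t3}" if "0 \<le> a" for a i
    using that by auto
  note * = this[of _ 1, unfolded F] this[of _ 2, unfolded F] this[of _ 3, unfolded F]
  have fired: "t3 \<notin> F 1" "t3 \<notin> F 2" "t3 \<in> F 3"
    using *[of 0] order by auto
  have "{a. 0 \<le> a \<and> a < \<tau> \<and> t3 - a \<in> F 1} = {a. 0 \<le> a \<and> a < \<tau> \<and> t3 - a \<in> {- \<sigma> $ 1, t1}}"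
    using *(1) by blast
  also have "\<dots> = {\<sigma> $ 3 - \<sigma> $ 2}" using order by auto
  finally have ages1: "{a. 0 \<le> a \<and> a < \<tau> \<and> t3 - a \<in> F 1} = {\<sigma> $ 3 - \<sigma> $ 2}" .
  have "{a. 0 \<le> a \<and> a < \<tau> \<and> t3 - a \<in> F 2} = {a. 0 \<le> a \<and> a < \<tau> \<and> t3 - a \<in> {- \<sigma> $ 2, t2}}"
    using *(2) by blast
  \<comment> \<open>At \<open>t3\<close> the firing at \<open>- \<sigma> $ 2\<close> has age exactly
    \<tau>; the strict bound \<open>a < \<tau>\<close> drops it.\<close>
  also have "\<dots> = {\<sigma> $ 1 - \<sigma> $ 2}" using order by auto
  finally have ages2: "{a. 0 \<le> a \<and> a < \<tau> \<and> t3 - a \<in> F 2} = {\<sigma> $ 1 - \<sigma> $ 2}" .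
  have "{a. 0 \<le> a \<and> a < \<tau> \<and> t3 - a \<in> F 3} = {a. 0 \<le> a \<and> a < \<tau> \<and> t3 - a \<in> {- \<sigma> $ 3, 0, t3}}"
    using *(3) by blast
  also have "\<dots> = {0, t3}" using order by auto
  finally have ages3: "{a. 0 \<le> a \<and> a < \<tau> \<and> t3 - a \<in> F 3} = {0, t3}" .
  show ?thesis
    using ages1 ages2 ages3 fired x
    by (auto simp: state_after_def S_def section_state_def S_phases_def vec_eq_iff forall_3 fun_eq_iff)
qed

text \<open>Values at event times are taken before any reset, hence equal 1 at each firing; the
  restart from 0 appears only in the following branch.\<close>

definition x_path :: "real \<Rightarrow> real ^ 3"
  where "x_path u = vector
    [if u < t1 then \<theta> $ 1 + u else if u = t1 then 1 else if u < t3 then u - t1 else h (t3 - t1),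
     if u < t1 then \<theta> $ 2 + u else if u < t2 then h (\<theta> $ 2 + t1) + (u - t1)
       else if u = t2 then 1 else u - t2,
     if u < t2 then u else if u < t3 then h t2 + (u - t2) else 1]"

definition F_path :: "3 \<Rightarrow> real set"
  where "F_path i = (if i = 1 then {- \<sigma> $ 1, t1} else if i = 2 then {- \<sigma> $ 2, t2} else {- \<sigma> $ 3, 0, t3})"

lemma F_path_simps [simp]:
  "F_path 1 = {- \<sigma> $ 1, t1}" "F_path 2 = {- \<sigma> $ 2, t2}" "F_path 3 = {- \<sigma> $ 3, 0, t3}"
  by (simp_all add: F_path_def)

lemma trajectory_path: "trajectory b \<epsilon> \<tau> (section_state \<theta> \<sigma>) t3 x_path F_path"
proof -
  define c0 c1 c2 :: "3 \<Rightarrow> real" where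
    "c0 i = \<theta> $ i" and
    "c1 i = (if i = 1 then - t1 else if i = 2 then h (\<theta> $ 2 + t1) - t1 else 0)" and
    "c2 i = (if i = 1 then - t1 else if i = 2 then - t2 else h t2 - t2)" for i
  have past: "has_past F_path"
    unfolding has_past_def forall_3 section_state_def using order by auto
  note at = arrivals_at[OF past]
  have le: "h t2 + (t3 - t2) \<le> 1" "h (\<theta> $ 2 + t1) + (t2 - t1) \<le> 1" "\<theta> $ 1 + t1 \<le> 1"
    using fires_1 fires_2 fires_3 by (auto simp: F3_def)
  have c: "c0 1 = \<theta> $ 1" "c0 2 = \<theta> $ 2" "c0 3 = 0" "c1 1 = - t1" "c1 2 = h (\<theta> $ 2 + t1) - t1"
    "c1 3 = 0" "c2 1 = - t1" "c2 2 = - t2" "c2 3 = h t2 - t2"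
    using phases by (auto simp: c0_def c1_def c2_def)
  have x: "x_path t1 $ 1 = 1" "x_path t1 $ 2 = h (\<theta> $ 2 + t1)" "x_path t1 $ 3 = t1"
    "x_path t2 $ 1 = t2 - t1" "x_path t2 $ 2 = 1" "x_path t2 $ 3 = h t2"
    "x_path t3 $ 1 = h (t3 - t1)" "x_path t3 $ 2 = t3 - t2" "x_path t3 $ 3 = 1"
    using order by (auto simp: x_path_def)
  have small: "0 < t1" "t1 < t2" "t2 < t3" "t2 < 1" "t3 - t1 < 1"
    using order bounds by auto
  have all: "P i" if "P 1" "P 2" "P 3" for P :: "3 \<Rightarrow> bool" and i
    using that exhaust_3[of i] by auto
  have nonneg: "0 \<le> h (\<theta> $ 2 + t1)" "0 \<le> h t2" "0 \<le> h (t3 - t1)"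
    using bounds phases small by auto
  have F_mem: "t1 \<in> F_path 1" "t1 \<notin> F_path 2" "t1 \<notin> F_path 3" "t2 \<notin> F_path 1" "t2 \<in> F_path 2"
    "t2 \<notin> F_path 3" "t3 \<notin> F_path 1" "t3 \<notin> F_path 2" "t3 \<in> F_path 3"
    using order by auto
  have one: "min 1 (h (\<theta> $ 1 + t1)) = 1" "min 1 (h (h (\<theta> $ 2 + t1) + (t2 - t1))) = 1"
    "min 1 (h (h t2 + (t3 - t2))) = 1"
    using absorbed_pulses by auto
  show ?thesis
  proof (rule trajectory_three_piecesI[of t1 t2 t3 _ _ _ c0 _ c1 c2])
    show "F_path i \<inter> {..0} = uminus ` snd (section_state \<theta> \<sigma>) i" for i
      using past by (simp add: has_past_def)
    show "F_path i \<inter> {0<..} \<subseteq> {t1, t2, t3}" for i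
      by (rule all) (use order in auto)
    show "arrivals \<tau> F_path i u = 0" if "0 < u" "u < t3" "u \<noteq> t1" "u \<noteq> t2" for i u
      using no_arrivals[OF past that] .
    show "c0 i = fst (section_state \<theta> \<sigma>) $ i" for i
      by (simp add: c0_def section_state_def)
    show "x_path u $ i = u + c0 i" if "0 < u" "u < t1" for i u
      by (rule all) (use that small in \<open>auto simp: x_path_def c\<close>)
    show "x_path u $ i = u + c1 i" if "t1 < u" "u < t2" for i u
      by (rule all) (use that small in \<open>auto simp: x_path_def c\<close>)
    show "x_path u $ i = u + c2 i" if "t2 < u" "u < t3" for i u
      by (rule all) (use that small in \<open>auto simp: x_path_def c\<close>)
    show "0 \<le> c0 i \<and> t1 + c0 i \<le> 1" for i
      by (rule all) (use small phases le bounds in \<open>auto simp: c\<close>)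
    show "0 \<le> t1 + c1 i \<and> t2 + c1 i \<le> 1" for i
      by (rule all) (use small nonneg le in \<open>auto simp: c\<close>)
    show "0 \<le> t2 + c2 i \<and> t3 + c2 i \<le> 1" for i
      by (rule all) (use small nonneg le in \<open>auto simp: c\<close>)
    show "x_path t1 $ i \<in> {0..1}" for i
      by (rule all) (use small nonneg bounds in \<open>auto simp: x\<close>)
    show "x_path t2 $ i \<in> {0..1}" for i
      by (rule all) (use small nonneg bounds in \<open>auto simp: x\<close>)
    show "x_path t3 $ i \<in> {0..1}" for i
      by (rule all) (use small nonneg bounds in \<open>auto simp: x\<close>)
    show "t1 \<in> F_path i \<longleftrightarrow> x_path t1 $ i = 1" for i
      by (rule all) (use small bounds F_mem x in auto)
    show "t2 \<in> F_path i \<longleftrightarrow> x_path t2 $ i = 1" for i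
      by (rule all) (use small bounds F_mem x in auto)
    show "t3 \<in> F_path i \<longleftrightarrow> x_path t3 $ i = 1" for i
      by (rule all) (use small bounds F_mem x in auto)
    show "x_path t1 $ i = (if arrivals \<tau> F_path i t1 = 0 then t1 + c0 i
        else min 1 (Hm b \<epsilon> (arrivals \<tau> F_path i t1) (t1 + c0 i)))" for i
      unfolding at
      by (rule all) (use one bounds in \<open>auto simp: c x add.commute\<close>)
    show "x_path t2 $ i = (if arrivals \<tau> F_path i t2 = 0 then t2 + c1 i
        else min 1 (Hm b \<epsilon> (arrivals \<tau> F_path i t2) (t2 + c1 i)))" for i
      unfolding at
      by (rule all) (use one bounds in \<open>auto simp: c x algebra_simps\<close>)
    show "x_path t3 $ i = (if arrivals \<tau> F_path i t3 = 0 then t3 + c2 i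
        else min 1 (Hm b \<epsilon> (arrivals \<tau> F_path i t3) (t3 + c2 i)))" for i
      unfolding at
      by (rule all) (use one bounds in \<open>auto simp: c x algebra_simps\<close>)
    show "t1 + c1 i = (if t1 \<in> F_path i then 0 else x_path t1 $ i)" for i
      by (rule all) (use F_mem in \<open>auto simp: c x\<close>)
    show "t2 + c2 i = (if t2 \<in> F_path i then 0 else x_path t2 $ i)" for i
      by (rule all) (use F_mem in \<open>auto simp: c x\<close>)
  qed (use small in auto)
qed

lemma poincare_iff: "poincare b \<epsilon> \<tau> (section_state \<theta> \<sigma>) s' \<longleftrightarrow> s' = S b \<epsilon> (G \<tau> \<sigma>)"
proof
  assume "poincare b \<epsilon> \<tau> (section_state \<theta> \<sigma>) s'"
  then obtain T x F where *: "trajectory b \<epsilon> \<tau> (section_state \<theta> \<sigma>) T x F" "T > 0" "T \<in> F 3"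
      "F 3 \<inter> {0<..<T} = {}" and s': "s' = state_after \<tau> T x F"
    unfolding poincare_def by blast
  note T = trajectory_on_section[OF *]
  show "s' = S b \<epsilon> (G \<tau> \<sigma>)"
    unfolding s' T(1) using T(2-) by (rule state_after_eq_S_G)
next
  assume s': "s' = S b \<epsilon> (G \<tau> \<sigma>)"
  have *: "t3 > 0" "t3 \<in> F_path 3" "F_path 3 \<inter> {0<..<t3} = {}"
    using order by auto
  \<comment> \<open>The forced description, applied to the explicit path itself, supplies its final
    state.\<close>
  note T = trajectory_on_section[OF trajectory_path *]
  have "s' = state_after \<tau> t3 x_path F_path"
    unfolding s' using T(2-) by (rule state_after_eq_S_G[symmetric])
  then show "poincare b \<epsilon> \<tau> (section_state \<theta> \<sigma>) s'"
    unfolding poincare_def using trajectory_path * by blast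
qed

end

section \<open>The unperturbed periodic orbits\<close>

lemma near_IR4_S_phases:
  assumes "b > 0" "\<epsilon> \<ge> 0" "\<sigma> \<in> Omega b \<epsilon> \<tau>"
  shows "near_IR4 b \<epsilon> \<tau> (S_phases b \<epsilon> \<sigma>) \<sigma>"
proof
  show "0 \<le> S_phases b \<epsilon> \<sigma> $ 1"
    using Hm_one_ge_self[OF assms(1,2), of "\<sigma> $ 1"] assms(3) by (simp add: S_phases_def Omega_def)
qed (use assms in \<open>auto simp: S_phases_def Omega_def F1_def F2_def algebra_simps\<close>)

lemma poincare_S_iff:
  assumes "b > 0" "\<epsilon> \<ge> 0" "\<sigma> \<in> Omega b \<epsilon> \<tau>"
  shows "poincare b \<epsilon> \<tau> (S b \<epsilon> \<sigma>) s' \<longleftrightarrow> s' = S b \<epsilon> (G \<tau> \<sigma>)"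
  unfolding S_def[of _ _ \<sigma>] by (rule near_IR4.poincare_iff[OF near_IR4_S_phases[OF assms]])

lemma poincare_funpow_S:
  assumes "b > 0" "\<epsilon> \<ge> 0" "\<sigma> \<in> Omega b \<epsilon> \<tau>"
  shows "(poincare b \<epsilon> \<tau> ^^ n) (S b \<epsilon> \<sigma>) (S b \<epsilon> ((G \<tau> ^^ n) \<sigma>))"
proof (induction n)
  case (Suc n)
  have "(G \<tau> ^^ n) \<sigma> \<in> Omega b \<epsilon> \<tau>"
    by (induction n) (auto intro: assms G_Omega)
  from Suc poincare_S_iff[OF assms(1,2) this] have "(poincare b \<epsilon> \<tau> ^^ Suc n) (S b \<epsilon> \<sigma>) (S b \<epsilon> (G \<tau> ((G \<tau> ^^ n) \<sigma>)))"
    by (blast intro: relpowp_Suc_I)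
  then show ?case by simp
qed simp

section \<open>Room for small perturbations\<close>

text \<open>
  Both \<^term>\<open>F1 b \<epsilon> \<tau>\<close> and \<^term>\<open>F2 b \<epsilon> \<tau>\<close> have slope \<open>-1\<close> in one coordinate of \<open>\<sigma>\<close>, so they
  cannot attain a bound at an interior point.
\<close>

lemma interior_Omega_strict:
  assumes "\<sigma> \<in> interior (Omega b \<epsilon> \<tau>)"
  shows "F1 b \<epsilon> \<tau> \<sigma> \<in> {Hstar b \<epsilon><..<1}" "F2 b \<epsilon> \<tau> \<sigma> \<in> {Hstar b \<epsilon><..<1}"
proof -
  obtain e where e: "e > 0" "ball \<sigma> e \<subseteq> Omega b \<epsilon> \<tau>"
    using assms mem_interior by blast
  have "\<sigma> + d *\<^sub>R axis k 1 \<in> Omega b \<epsilon> \<tau>" if "\<bar>d\<bar> < e" for k d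
    using that e(2) by (auto simp: dist_norm)
  from this[of "e/2" 3] this[of "- e/2" 3] this[of "e/2" 1] this[of "- e/2" 1] e(1)
  show "F1 b \<epsilon> \<tau> \<sigma> \<in> {Hstar b \<epsilon><..<1}" "F2 b \<epsilon> \<tau> \<sigma> \<in> {Hstar b \<epsilon><..<1}"
    by (auto simp: Omega_def F1_def F2_def axis_def algebra_simps)
qed

text \<open>The conditions involving phases persist by continuity. Those on \<sigma> alone follow
  from \<open>\<sigma> + q\<close> staying in \<open>Omega\<close>.\<close>

lemma near_IR4_perturbation:
  assumes "b > 0" "\<epsilon> \<ge> 0" and int: "\<sigma> \<in> interior (Omega b \<epsilon> \<tau>)"
  obtains \<delta> where "\<delta> > 0"
    "\<And>p q. p $ 3 = 0 \<Longrightarrow> norm p < \<delta> \<Longrightarrow> norm q < \<delta> \<Longrightarrow>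
      \<sigma> + q \<in> Omega b \<epsilon> \<tau> \<and> near_IR4 b \<epsilon> \<tau> (S_phases b \<epsilon> \<sigma> + p) (\<sigma> + q)"
proof -
  let ?\<theta> = "S_phases b \<epsilon> \<sigma>"
  \<comment> \<open>The quantities of \<open>fires_1\<close> and \<open>fires_2\<close> for
    perturbed data. At \<open>(0, 0)\<close> they equal \<open>F1\<close> and \<open>F2\<close>,
    which lie strictly inside their range.\<close>
  define g1 g2 :: "(real ^ 3) \<times> (real ^ 3) \<Rightarrow> real" where
    "g1 z = (?\<theta> + fst z) $ 1 + (\<tau> - (\<sigma> + snd z) $ 3)" and
    "g2 z = Hm b \<epsilon> 1 ((?\<theta> + fst z) $ 2 + (\<tau> - (\<sigma> + snd z) $ 3)) +
      ((\<sigma> + snd z) $ 3 - (\<sigma> + snd z) $ 1)" for z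
  define U where "U = (\<lambda>z. \<sigma> + snd z) -` interior (Omega b \<epsilon> \<tau>) \<inter>
    {z. 0 < (?\<theta> + fst z) $ 1} \<inter> {z. 0 < (?\<theta> + fst z) $ 2} \<inter>
    g1 -` {Hstar b \<epsilon><..<1} \<inter> g2 -` {Hstar b \<epsilon><..<1}"
  have "open U"
    unfolding U_def g1_def g2_def Hm_def pulse_def
    by (intro open_Int open_vimage open_Collect_less continuous_intros open_interior open_greaterThanLessThan)
  moreover have "(0, 0) \<in> U"
  proof -
    have "\<sigma> \<in> Omega b \<epsilon> \<tau>" using int interior_subset by blast
    then have "0 < \<sigma> $ 1" "0 < \<sigma> $ 2" by (auto simp: Omega_def)
    then show ?thesis
      using int interior_Omega_strict[OF int] Hm_one_ge_self[OF assms(1,2), of "\<sigma> $ 1"]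
      by (auto simp: U_def g1_def g2_def S_phases_def F1_def F2_def algebra_simps)
  qed
  ultimately obtain e where e: "e > 0" "ball (0, 0) e \<subseteq> U"
    by (meson openE)
  show ?thesis
  proof (rule that[of "e / 2"])
    fix p q :: "real ^ 3"
    assume p: "p $ 3 = 0" "norm p < e / 2" and q: "norm q < e / 2"
    have "norm (p, q) \<le> norm p + norm q" by (rule norm_Pair_le)
    then have "(p, q) \<in> ball 0 e" using p q by simp
    then have U: "(p, q) \<in> U" using e(2) by (auto simp: zero_prod_def)
    then have \<sigma>q: "\<sigma> + q \<in> Omega b \<epsilon> \<tau>"
      using interior_subset by (auto simp: U_def)
    moreover have "near_IR4 b \<epsilon> \<tau> (?\<theta> + p) (\<sigma> + q)"
    proof
      show "(?\<theta> + p) $ 3 = 0" using p(1) by (simp add: S_phases_def)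
    qed (use U \<sigma>q assms in \<open>auto simp: U_def g1_def g2_def Omega_def\<close>)
    ultimately show "\<sigma> + q \<in> Omega b \<epsilon> \<tau> \<and> near_IR4 b \<epsilon> \<tau> (?\<theta> + p) (\<sigma> + q)" ..
  qed (use e in auto)
qed

theorem mainTheorem4:
  fixes b \<epsilon> \<tau> :: real and \<sigma> :: "real ^ 3"
  assumes "b > 0" and "\<epsilon> \<ge> 0" and "\<tau> > 0"
    and "\<sigma> \<in> interior (Omega b \<epsilon> \<tau>)"
  shows "\<exists>\<delta>>0. \<forall>\<Delta>\<theta> \<Delta>\<sigma> :: real ^ 3.
    \<Delta>\<theta> $ 3 = 0 \<and> norm \<Delta>\<theta> < \<delta> \<and> norm \<Delta>\<sigma> < \<delta> \<longrightarrow>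
      \<sigma> + \<Delta>\<sigma> \<in> Omega b \<epsilon> \<tau> \<and>
      (poincare b \<epsilon> \<tau> ^^ 4) (S b \<epsilon> (\<sigma> + \<Delta>\<sigma>)) (S b \<epsilon> (\<sigma> + \<Delta>\<sigma>)) \<and>
      (\<exists>!s'. poincare b \<epsilon> \<tau> (section_state (S_phases b \<epsilon> \<sigma> + \<Delta>\<theta>) (\<sigma> + \<Delta>\<sigma>)) s') \<and>
      (\<forall>s'. poincare b \<epsilon> \<tau> (section_state (S_phases b \<epsilon> \<sigma> + \<Delta>\<theta>) (\<sigma> + \<Delta>\<sigma>)) s' \<longrightarrow>
            s' \<in> Y b \<epsilon> \<tau> (\<sigma> + \<Delta>\<sigma>))"
proof -
  obtain \<delta> where "\<delta> > 0" and \<delta>: "\<And>p q. p $ 3 = 0 \<Longrightarrow> norm p < \<delta> \<Longrightarrow> norm q < \<delta> \<Longrightarrow>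
      \<sigma> + q \<in> Omega b \<epsilon> \<tau> \<and> near_IR4 b \<epsilon> \<tau> (S_phases b \<epsilon> \<sigma> + p) (\<sigma> + q)"
    using near_IR4_perturbation[OF assms(1,2,4)] by blast
  show ?thesis
  proof (intro exI[of _ \<delta>] conjI allI impI)
    fix p q :: "real ^ 3"
    assume "p $ 3 = 0 \<and> norm p < \<delta> \<and> norm q < \<delta>"
    then have \<Omega>: "\<sigma> + q \<in> Omega b \<epsilon> \<tau>" and near: "near_IR4 b \<epsilon> \<tau> (S_phases b \<epsilon> \<sigma> + p) (\<sigma> + q)"
      using \<delta> by auto
    show "\<sigma> + q \<in> Omega b \<epsilon> \<tau>" by fact
    show "(poincare b \<epsilon> \<tau> ^^ 4) (S b \<epsilon> (\<sigma> + q)) (S b \<epsilon> (\<sigma> + q))"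
      using poincare_funpow_S[OF assms(1,2) \<Omega>, of 4] unfolding G_funpow_4 .
    note iff = near_IR4.poincare_iff[OF near]
    show "\<exists>!s'. poincare b \<epsilon> \<tau> (section_state (S_phases b \<epsilon> \<sigma> + p) (\<sigma> + q)) s'"
      unfolding iff by simp
    fix s'
    assume "poincare b \<epsilon> \<tau> (section_state (S_phases b \<epsilon> \<sigma> + p) (\<sigma> + q)) s'"
    \<comment> \<open>The perturbed state and \<open>S b \<epsilon> (\<sigma> + q)\<close> have the
      same image, so that image lies on the orbit of the latter.\<close>
    then have "poincare b \<epsilon> \<tau> (S b \<epsilon> (\<sigma> + q)) s'"
      unfolding iff poincare_S_iff[OF assms(1,2) \<Omega>] .
    then show "s' \<in> Y b \<epsilon> \<tau> (\<sigma> + q)"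
      by (auto simp: Y_def orbit_def)
  qed fact
qed

end
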